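(* Let $V$ be a finite-dimensional real inner product space, let $V_1,\dots,V_n\subseteq V$ be subspaces with $V=\sum_{i=1}^n V_i$ (the sum not necessarily direct), and let $A:V\to V^*$ be a linear operator. Let $\underline{V}=\prod_{i=1}^n V_i$, let $S:\underline{V}\to V$, $S(v_1,\dots,v_n)=\sum_{i=1}^n v_i$, with adjoint $S^*:V^*\to\underline{V}^*$, and let $\underline{B}:\underline{V}^*\to\underline{V}$ be a linear operator. Put $\underline{A}=S^*AS$, $B=S\underline{B}S^*:V^*\to V$, $T=BA:V\to V$ and $\underline{T}=\underline{B}\,\underline{A}:\underline{V}\to\underline{V}$. If $T$ is an isomorphism, then for every $f\in V^*$, with $\underline{f}=S^*f$, the linear system $$\underline{T}\,\underline{u}=\underline{B}\,\underline{f}$$ admits a Krylov solution, i.e. there exist an integer $s\ge 1$ and an element $\underline{u}\in K_s(\underline{T},\underline{B}\,\underline{f})$ such that $\underline{T}\,\underline{u}=\underline{B}\,\underline{f}$.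
   Context: $V^*$ denotes the dual space of $V$, and $\underline{V}^*=\prod_{i=1}^n V_i^*$ the dual of $\underline{V}$. The adjoint $S^*$ is the dual (transpose) map $S^*f=(f|_{V_1},\dots,f|_{V_n})$. For a linear endomorphism $T$ of a vector space, a vector $y$ of that space and an integer $s\ge1$, the Krylov subspace is $K_s(T,y)=\operatorname{span}\{y,Ty,\dots,T^{s-1}y\}$. A Krylov solution of $Tx=y$ is a solution $x$ belonging to $K_s(T,y)$ for some $s\ge 1$. *)

theory Defs
  imports "HOL-Analysis.Analysis" "HOL-Library.Function_Algebras"
begin

text \<open>
  Functions into a real vector space form a real vector space under the pointwise operations.
  This covers both tuples (functions on the index type) and real-valued functionals.
\<close>

instantiation "fun" :: (type, real_vector) real_vector
begin

definition scaleR_fun :: "real \<Rightarrow> ('a \<Rightarrow> 'b) \<Rightarrow> 'a \<Rightarrow> 'b"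
  where "scaleR_fun c f = (\<lambda>x. c *\<^sub>R f x)"

instance
  by standard (auto simp: scaleR_fun_def fun_eq_iff algebra_simps)

end

definition linear_on :: "'a::real_vector set \<Rightarrow> ('a \<Rightarrow> 'b::real_vector) \<Rightarrow> bool"
  where "linear_on W f \<longleftrightarrow>
    (\<forall>x\<in>W. \<forall>y\<in>W. f (x + y) = f x + f y) \<and> (\<forall>c. \<forall>x\<in>W. f (c *\<^sub>R x) = c *\<^sub>R f x)"

lemma linear_on_UNIV: "linear_on UNIV f \<longleftrightarrow> linear f"
  by (auto simp: linear_on_def linear_iff)

text \<open>
  The dual of a subspace \<open>W\<close>. A functional on \<open>W\<close> is represented by a function on the ambient
  type; the value 0 prescribed outside \<open>W\<close> is a mere convention making the representative unique.
\<close>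

definition dual_space :: "'a::real_vector set \<Rightarrow> ('a \<Rightarrow> real) set"
  where "dual_space W = {f. linear_on W f \<and> (\<forall>x. x \<notin> W \<longrightarrow> f x = 0)}"

lemma dual_space_UNIV: "dual_space UNIV = {f. linear f}"
  by (simp add: dual_space_def linear_on_UNIV)

lemma subspace_dual_space: "subspace W \<Longrightarrow> subspace (dual_space W)"
  unfolding subspace_def dual_space_def linear_on_def
  by (auto simp: scaleR_fun_def algebra_simps)

definition prod_space :: "('i \<Rightarrow> 'a set) \<Rightarrow> ('i \<Rightarrow> 'a) set"
  where "prod_space V = {v. \<forall>i. v i \<in> V i}"

definition prod_dual :: "('i \<Rightarrow> 'a::real_vector set) \<Rightarrow> ('i \<Rightarrow> 'a \<Rightarrow> real) set"
  where "prod_dual V = prod_space (\<lambda>i. dual_space (V i))"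

lemma subspace_prod_space: "(\<And>i. subspace (V i)) \<Longrightarrow> subspace (prod_space V)"
  by (auto simp: subspace_def prod_space_def scaleR_fun_def)

lemma subspace_prod_dual: "(\<And>i. subspace (V i)) \<Longrightarrow> subspace (prod_dual V)"
  unfolding prod_dual_def by (intro subspace_prod_space subspace_dual_space)

definition sum_map :: "('i::finite \<Rightarrow> 'a::real_vector) \<Rightarrow> 'a"
  where "sum_map v = (\<Sum>i\<in>UNIV. v i)"

text \<open>
  The transpose of \<^const>\<open>sum_map\<close> on the product of the \<open>V i\<close>: the tuple of restrictions
  of \<open>f\<close> to the \<open>V i\<close>.
\<close>

definition sum_adj :: "('i \<Rightarrow> 'a::real_vector set) \<Rightarrow> ('a \<Rightarrow> real) \<Rightarrow> 'i \<Rightarrow> 'a \<Rightarrow> real"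
  where "sum_adj V f = (\<lambda>i x. if x \<in> V i then f x else 0)"

lemma sum_adj_in_prod_dual:
  assumes "\<And>i. subspace (V i)" and "f \<in> dual_space UNIV"
  shows "sum_adj V f \<in> prod_dual V"
  using assms
  by (auto simp: sum_adj_def prod_dual_def prod_space_def dual_space_def linear_on_def
      subspace_add subspace_scale)

lemma sum_adj_transpose:
  assumes "f \<in> dual_space UNIV" and "v \<in> prod_space V"
  shows "(\<Sum>i\<in>UNIV. sum_adj V f i (v i)) = f (sum_map v)"
  using assms by (simp add: sum_adj_def prod_space_def dual_space_UNIV sum_map_def linear_sum)

definition krylov :: "nat \<Rightarrow> ('a::real_vector \<Rightarrow> 'a) \<Rightarrow> 'a \<Rightarrow> 'a set"
  where "krylov s T y = span ((\<lambda>k. (T ^^ k) y) ` {..<s})"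

definition krylov_solution :: "('a::real_vector \<Rightarrow> 'a) \<Rightarrow> 'a \<Rightarrow> 'a \<Rightarrow> bool"
  where "krylov_solution T y x \<longleftrightarrow> T x = y \<and> (\<exists>s\<ge>1. x \<in> krylov s T y)"

end

theory Submission
  imports Defs
begin

text \<open>
  Put \<open>S = sum_map\<close> and \<open>R = B\<^sub>p \<circ> sum_adj V \<circ> A\<close>. Then \<open>T = S \<circ> R\<close> and \<open>T\<^sub>p = R \<circ> S\<close>, so \<open>R\<close> intertwines
  \<open>T\<close> with \<open>T\<^sub>p\<close>. Since \<open>T\<close> is injective, so is \<open>A\<close>, and equality of dimensions gives \<open>f = A w\<close> for
  some \<open>w\<close>; the right-hand side is thus \<open>R w\<close>. The span of the \<open>T\<close>-orbit of \<open>w\<close> is mapped injectively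
  into itself, hence onto itself, so \<open>w = T v\<close> for some \<open>v\<close> in it, and \<open>R v\<close> is a Krylov solution.
\<close>

lemma linear_functionals_eq_on_spanning_set:
  fixes f g :: "'a::real_vector \<Rightarrow> real"
  assumes "f \<in> dual_space UNIV" "g \<in> dual_space UNIV" "span E = UNIV"
    and "\<And>b. b \<in> E \<Longrightarrow> f b = g b"
  shows "f = g"
  using linear_eq_on_span[of f g E] assms by (auto simp: dual_space_UNIV)

lemma finite_basis_exists:
  assumes "\<exists>E :: ('a::real_vector) set. finite E \<and> span E = UNIV"
  obtains E :: "('a::real_vector) set" where "finite E" "independent E" "span E = UNIV"
proof -
  obtain E :: "'a set" where E: "finite E" "span E = UNIV"
    using assms by blast
  obtain C where "C \<subseteq> E" "independent C" "E \<subseteq> span C"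
    using real_vector.maximal_independent_subset[of E] by blast
  then show thesis
    using that[of C] E span_mono[of E "span C"] by (auto simp: span_span intro: finite_subset)
qed

lemma finite_dimensional_inj_image_eq:
  fixes g :: "'a::real_vector \<Rightarrow> 'a"
  assumes fin_dim: "\<exists>E :: 'a set. finite E \<and> span E = UNIV"
    and g: "linear g" "inj g"
    and W: "subspace W" "g ` W \<subseteq> W"
  shows "g ` W = W"
proof -
  obtain E :: "'a set" where "finite E" "independent E" "span E = UNIV"
    using finite_basis_exists[OF fin_dim] .
  \<comment> \<open>Finite dimension is an assumption here rather than a type class, so the
    dimension theory is obtained from the locale with \<open>E\<close> as its basis.\<close>
  then interpret finite_dimensional_vector_space_pair_1
    "scaleR :: real \<Rightarrow> 'a \<Rightarrow> 'a" E "scaleR :: real \<Rightarrow> 'a \<Rightarrow> 'a"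
    by unfold_locales (auto simp: dependent_raw_def span_raw_def)
  have "dim (g ` W) = dim W"
    using dim_image_eq[of g W] g by (simp add: linear_def dim_raw_def inj_on_subset)
  then show ?thesis
    using vs1.subspace_dim_equal[of "g ` W" W] W linear_subspace_image[OF g(1) W(1)]
    by (simp add: subspace_raw_def dim_raw_def)
qed

text \<open>Pairing a functional with a finite basis turns \<open>A\<close> into an endomorphism, so the dimension
  of the dual space need not be computed.\<close>

lemma inj_into_dual_imp_onto_dual:
  fixes A :: "'a::real_vector \<Rightarrow> 'a \<Rightarrow> real"
  assumes fin_dim: "\<exists>E :: 'a set. finite E \<and> span E = UNIV"
    and A: "linear A" "inj A" "\<And>v. A v \<in> dual_space UNIV"
    and f: "f \<in> dual_space UNIV"
  obtains w where "A w = f"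
proof -
  obtain E :: "'a set" where E: "finite E" "independent E" "span E = UNIV"
    using finite_basis_exists[OF fin_dim] .
  define \<phi> :: "('a \<Rightarrow> real) \<Rightarrow> 'a" where "\<phi> g = (\<Sum>b\<in>E. g b *\<^sub>R b)" for g
  have \<phi>_eqD: "g = h" if "g \<in> dual_space UNIV" "h \<in> dual_space UNIV" "\<phi> g = \<phi> h" for g h
  proof (rule linear_functionals_eq_on_spanning_set[OF that(1,2) E(3)])
    \<comment> \<open>Equal values of \<open>\<phi>\<close> give a vanishing combination of basis
      vectors; independence makes its coefficients zero, so \<open>g\<close> and \<open>h\<close>
      agree on \<open>E\<close>.\<close>
    have "(\<Sum>b\<in>E. (g b - h b) *\<^sub>R b) = 0"
      using that(3) by (simp add: \<phi>_def scaleR_left_diff_distrib sum_subtractf)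
    then show "g b = h b" if "b \<in> E" for b
      using independentD[OF E(2,1) order_refl _ that, of "\<lambda>b. g b - h b"] by simp
  qed
  have "linear (\<phi> \<circ> A)"
    unfolding linear_iff \<phi>_def
    by (simp add: linear_add[OF A(1)] linear_cmul[OF A(1)] scaleR_fun_def scaleR_left_distrib
        sum.distrib scaleR_sum_right)
  moreover have "inj (\<phi> \<circ> A)"
    using \<phi>_eqD A(2,3) by (metis comp_apply injI injD)
  ultimately have "surj (\<phi> \<circ> A)"
    by (intro finite_dimensional_inj_image_eq[OF fin_dim]) auto
  then obtain w where "\<phi> (A w) = \<phi> f"
    by (metis comp_apply surjD)
  then show thesis
    using that \<phi>_eqD A(3) f by blast
qed

lemma funpow_intertwine:
  assumes "\<And>x. S (R x) = R (T x)"
  shows "(S ^^ k) (R x) = R ((T ^^ k) x)"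
  by (induction k) (simp_all add: assms)

text \<open>A linear combination involves only finitely many iterates, so a bound on their exponents
  gives a suitable \<open>s\<close>.\<close>

lemma exists_krylov_of_span_orbit:
  assumes "x \<in> span (range (\<lambda>k. (T ^^ k) y))"
  shows "\<exists>s\<ge>1. x \<in> krylov s T y"
proof -
  obtain F where F: "finite F" "F \<subseteq> range (\<lambda>k. (T ^^ k) y)" "x \<in> span F"
    using assms unfolding span_explicit by blast
  then obtain K where K: "finite K" "F = (\<lambda>k. (T ^^ k) y) ` K"
    by (meson finite_subset_image)
  then obtain s where "K \<subseteq> {..<s}"
    using finite_nat_iff_bounded by blast
  \<comment> \<open>Passing to \<open>Suc s\<close> secures an index of at least 1 even if
    \<open>K\<close> is empty.\<close>
  then have "F \<subseteq> (\<lambda>k. (T ^^ k) y) ` {..<Suc s}"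
    using K(2) by auto
  then show ?thesis
    unfolding krylov_def using F(3) span_mono by (intro exI[of _ "Suc s"]) auto
qed

lemma finite_dimensional_orbit_preimage:
  fixes T :: "'a::real_vector \<Rightarrow> 'a"
  assumes fin_dim: "\<exists>E :: 'a set. finite E \<and> span E = UNIV"
    and T: "linear T" "inj T"
  obtains v where "v \<in> span (range (\<lambda>k. (T ^^ k) w))" "T v = w"
proof -
  define W where "W = span (range (\<lambda>k. (T ^^ k) w))"
  have "(T ^^ k) w \<in> W" for k
    unfolding W_def by (intro span_base) auto
  \<comment> \<open>Exponent 0 gives \<open>w\<close> itself; successor exponents show that
    \<open>T\<close> maps the generators into \<open>W\<close>.\<close>
  from this[of 0] this[of "Suc _"] have "w \<in> W" "T ` range (\<lambda>k. (T ^^ k) w) \<subseteq> W"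
    by auto
  then have "T ` W \<subseteq> W"
    unfolding W_def linear_span_image[OF T(1), symmetric] by (simp add: span_minimal)
  then have "T ` W = W"
    by (intro finite_dimensional_inj_image_eq[OF fin_dim T]) (auto simp: W_def)
  with \<open>w \<in> W\<close> that show thesis
    unfolding W_def by (metis imageE)
qed

lemma linear_sum_map: "linear sum_map"
  by (simp add: linear_iff sum_map_def sum.distrib scaleR_sum_right scaleR_fun_def)

lemma linear_sum_adj: "linear (sum_adj V)"
  by (auto simp: linear_iff sum_adj_def fun_eq_iff scaleR_fun_def)

theorem proposition1:
  fixes V :: "'n::finite \<Rightarrow> 'v::real_inner set"
    and A :: "'v \<Rightarrow> 'v \<Rightarrow> real"
    and B\<^sub>p :: "('n \<Rightarrow> 'v \<Rightarrow> real) \<Rightarrow> 'n \<Rightarrow> 'v"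
    and A\<^sub>p :: "('n \<Rightarrow> 'v) \<Rightarrow> 'n \<Rightarrow> 'v \<Rightarrow> real"
    and B :: "('v \<Rightarrow> real) \<Rightarrow> 'v"
    and T :: "'v \<Rightarrow> 'v"
    and T\<^sub>p :: "('n \<Rightarrow> 'v) \<Rightarrow> 'n \<Rightarrow> 'v"
  assumes fin_dim: "\<exists>E :: 'v set. finite E \<and> span E = UNIV"
    and subspaces: "\<And>i. subspace (V i)"
    and sum_V: "sum_map ` prod_space V = UNIV"
    and A_lin: "linear A"
    and A_dual: "\<And>v. A v \<in> dual_space UNIV"
    and Bp_lin: "linear_on (prod_dual V) B\<^sub>p"
    and Bp_prod: "\<And>g. g \<in> prod_dual V \<Longrightarrow> B\<^sub>p g \<in> prod_space V"
    and Ap: "A\<^sub>p = sum_adj V \<circ> A \<circ> sum_map"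
    and B: "B = sum_map \<circ> B\<^sub>p \<circ> sum_adj V"
    and T: "T = B \<circ> A"
    and Tp: "T\<^sub>p = B\<^sub>p \<circ> A\<^sub>p"
    and T_iso: "bij T"
    and f: "f \<in> dual_space UNIV"
  shows "\<exists>u\<in>prod_space V. krylov_solution T\<^sub>p (B\<^sub>p (sum_adj V f)) u"
proof -
  define R where "R x = B\<^sub>p (sum_adj V (A x))" for x
  \<comment> \<open>\<open>B\<^sub>p\<close> is linear only on \<open>prod_dual V\<close>, so this
    membership is what makes \<open>R\<close> linear on the whole space.\<close>
  have adj: "sum_adj V (A x) \<in> prod_dual V" for x
    using sum_adj_in_prod_dual[OF subspaces A_dual] .
  have R_lin: "linear R"
    using Bp_lin adj unfolding R_def linear_on_def linear_iff
    by (simp add: linear_add[OF A_lin] linear_cmul[OF A_lin] linear_add[OF linear_sum_adj]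
        linear_cmul[OF linear_sum_adj])
  have T_eq: "T x = sum_map (R x)" for x
    by (simp add: T B R_def)
  have Tp_eq: "T\<^sub>p v = R (sum_map v)" for v
    by (simp add: Tp Ap R_def)
  have T_lin: "linear T"
    using linear_compose[OF R_lin linear_sum_map] by (simp add: T_eq[abs_def] comp_def)
  have "inj T"
    using T_iso by (rule bij_is_inj)
  then have "inj A"
    unfolding T by (rule inj_on_imageI2)
  then obtain w where w: "A w = f"
    using inj_into_dual_imp_onto_dual[OF fin_dim A_lin _ A_dual f] by blast
  obtain v where v: "v \<in> span (range (\<lambda>k. (T ^^ k) w))" "T v = w"
    using finite_dimensional_orbit_preimage[OF fin_dim T_lin \<open>inj T\<close>] .
  \<comment> \<open>Linearity moves \<open>R\<close> inside the span, and the intertwining relation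
    turns the \<open>T\<close>-orbit of \<open>w\<close> into the \<open>T\<^sub>p\<close>-orbit of
    \<open>R w\<close>.\<close>
  have "R v \<in> span (R ` range (\<lambda>k. (T ^^ k) w))"
    using v(1) by (simp add: linear_span_image[OF R_lin])
  also have "R ` range (\<lambda>k. (T ^^ k) w) = range (\<lambda>k. (T\<^sub>p ^^ k) (R w))"
    using funpow_intertwine[of T\<^sub>p R T] by (simp add: Tp_eq T_eq image_image)
  finally have "\<exists>s\<ge>1. R v \<in> krylov s T\<^sub>p (R w)"
    by (rule exists_krylov_of_span_orbit)
  moreover have "T\<^sub>p (R v) = R w"
    using v(2) by (simp add: Tp_eq T_eq)
  moreover have "R w = B\<^sub>p (sum_adj V f)"
    by (simp add: R_def w)
  moreover have "R v \<in> prod_space V"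
    unfolding R_def by (rule Bp_prod[OF adj])
  ultimately show ?thesis
    by (auto simp: krylov_solution_def)
qed

end
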